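(* Let $\lambda>p>0$, $0<T<\infty$, and let $\Omega\subset\mathbb{R}^n$ ($n\ge1$) be a bounded domain with $C^2$-smooth boundary, $Q=(0,T)\times\Omega$. Let $a_i(t,x,s,\xi)$, $i=1,\dots,n$, be continuous functions satisfying, for constants $d_0>0$ and $d_1<\infty$ and all $(t,x,s,\xi)\in\overline{Q}\times\mathbb{R}\times\mathbb{R}^n$, $$d_0|\xi|^{p+1}\le\sum_{i=1}^n a_i(t,x,s,\xi)\xi_i,\qquad |a_i(t,x,s,\xi)|\le d_1|\xi|^p\quad(i=1,\dots,n).$$ Let $b(t,x)$ be continuous on $[0,T]\times\overline\Omega$ with $b>0$ in $[0,T)\times\overline\Omega$, $b=0$ on $\{T\}\times\Omega$, and $$a_1(t)g_1(d(x))\le b(t,x)\le a_2(t)g_2(d(x))\qquad\forall\,(t,x)\in[0,T)\times\Omega,$$ where $g_1(s)=as^\nu$ with constants $a>0$, $\nu>0$, $g_2\ge g_1$ is nondecreasing, and $a_1,a_2$ are positive continuous functions on $[0,T)$ with $a_1(t)\ge c_0\exp\left(-\omega(T-t)^{-\frac1{p+\mu}}\right)$ for all $t<T$, for constants $c_0,\omega,\mu>0$. Let $u$ be an arbitrary weak (energy) solution of $$(|u|^{p-1}u)_t-\sum_{i=1}^n(a_i(t,x,u,\nabla u))_{x_i}=-b(t,x)|u|^{\lambda-1}u\quad\text{in }Q .$$ Let $K_1$, $K_2$, $s_0'$ be the constants described in the context. Then for all $t\in\left(\frac T2,T\right)$ and all $s\in(0,s_0')$, $$\int_{\Omega(s)}|u(t,x)|^{p+1}dx+\int_{\frac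 T2}^t\int_{\Omega(s)}|\nabla_xu(\tau,x)|^{p+1}dx\,d\tau\le K_3\exp\left(K_2(1-\rho)^{-\frac{p+1}{\mu}}\omega^{\frac{p+\mu}{\mu}}s^{-\frac{p+1}{\mu}}\right)\rho^{-\kappa}s^{-\kappa},$$ where $$\kappa=\frac{(\nu+1)(p+1)+p(\lambda+1)}{\lambda-p},\qquad K_3=K_1a^{-\frac{p+1}{\lambda-p}}\left(1+\frac{\nu(p+1)}{1+p(\lambda+2)}\right)^{\frac{1+p(\lambda+2)}{\lambda-p}},$$ and $$\rho=\rho\left(\frac{\mu\kappa\, s^{\frac{p+1}{\mu}}}{K_2\,\omega^{\frac{p+\mu}{\mu}}(p+1)}\right),$$ with $\rho(\tau)$ the function defined by the equation $$\rho-\tau(1-\rho)^{\frac{p+\mu+1}{\mu}}=0\qquad\forall\,\tau>0 .$$ Moreover $\rho(\cdot):(0,\infty)\to(0,1)$ is monotonically increasing, and $\rho(\tau)\tau^{-1}\to1$ as $\tau\to0$.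
   Context: $d(x)=\mathrm{dist}(x,\partial\Omega)$ and $\Omega(s)=\{x\in\Omega:d(x)>s\}$. The constants $K_1,K_2<\infty$ (depending only on known parameters, i.e. the data of the problem, and not on $u,t,s$) and $s_0'=c_3\min\left(1,\omega^{\frac{p+\mu}{p+1}}\right)$ (with $c_3$ depending on $p,n,d_0,d_1$ only) are the constants of the following general estimate, valid for arbitrary nondecreasing functions $g_1\le g_2$ positive for $s>0$ in the two-sided condition $a_1(t)g_1(d(x))\le b(t,x)\le a_2(t)g_2(d(x))$ for all $(t,x)\in[0,T)\times\Omega$, where $a_1,a_2$ are positive continuous functions on $[0,T)$ with $a_1(t)\ge c_0\exp\left(-\omega(T-t)^{-\frac1{p+\mu}}\right)$ for all $t<T$, for every weak (energy) solution $u$, all $\frac T2<t<T$ and all $s\in(0,s_0')$: $$\int_{\Omega(s)}|u(t,x)|^{p+1}dx+\int_{\frac T2}^t\int_{\Omega(s)}|\nabla_xu|^{p+1}dx\,d\tau\le K_1\min_{0<\bar s<s}\left\{\exp\left(K_2\,\omega^{\frac{p+\mu}{\mu}}(s-\bar s)^{-\frac{p+1}{\mu}}\right)\left(\int_0^{\bar s}g_1(h)^{\frac{p+1}{1+p(\lambda+2)}}dh\right)^{-\frac{1+p(\lambda+2)}{\lambda-p}}\right\}.$$ Weak (energy) solution of the equation $(|u|^{p-1}u)_t-\sum_{i=1}^n(a_i(t,x,u,\nabla u))_{x_i}=-b(t,x)|u|^{\lambda-1}u$ in $Q$ (no initial or boundary condition is prescribed): a function $u\in C_{loc}((0,T);L^{p+1}(\Omega))$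 such that $$u\in L^{p+1}_{loc}\big((0,T);W^{1,p+1}_{loc}(\Omega)\big)\cap L^{\lambda+1}_{loc}\big((0,T)\times\Omega\big),$$ $$(|u|^{p-1}u)_t\in L^{\frac{p+1}p}_{loc}\big((0,T);(W^{1,p+1}_c(\Omega))^*\big)+L^{\frac{\lambda+1}{\lambda}}_{loc}\big((0,T);(L^{\lambda+1}_c(\Omega))^*\big),$$ and $$\int_{t_1}^{t_2}\langle(|u|^{p-1}u)_t,\eta\rangle\,dt+\int_{t_1}^{t_2}\int_\Omega\Big[\sum_{i=1}^na_i(t,x,u,\nabla u)\eta_{x_i}+b(t,x)|u|^{\lambda-1}u\,\eta\Big]dx\,dt=0$$ for arbitrary $0<t_1<t_2<T$ and arbitrary $\eta\in L^{p+1}_{loc}((0,T);W^{1,p+1}_c(\Omega))\cap L^{\lambda+1}_{loc}((0,T);L^{\lambda+1}_c(\Omega))$. Here $W^{1,p+1}_c(\Omega)$, $L^{\lambda+1}_c(\Omega)$ are the subspaces of $W^{1,p+1}(\Omega)$, $L^{\lambda+1}(\Omega)$ of functions with compact support in $\Omega$, and $\langle\cdot,\cdot\rangle$ is the pairing between $W^{1,p+1}_c(\Omega)\cap L^{\lambda+1}_c(\Omega)$ and its dual. *)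

theory Defs
  imports "HOL-Analysis.Analysis"
begin

text \<open>Domains with \<open>C\<^sup>2\<close> boundary. A function of \<open>n - 1\<close> variables is encoded as a
  function on \<open>\<real>\<^sup>n\<close> that does not vary in the direction of a unit vector \<open>e\<close>; near each boundary
  point the domain is the part above the graph of such a function over the hyperplane
  orthogonal to \<open>e\<close>.\<close>

definition C2_function :: "(real ^ 'n \<Rightarrow> real) \<Rightarrow> bool" where
  "C2_function f \<longleftrightarrow> (\<exists>(G :: real ^ 'n \<Rightarrow> real ^ 'n) (H :: real ^ 'n \<Rightarrow> real ^ 'n ^ 'n).
     (\<forall>x. (f has_derivative (\<lambda>h. G x \<bullet> h)) (at x)) \<and>
     (\<forall>x. (G has_derivative (\<lambda>h. H x *v h)) (at x)) \<and>
     continuous_on UNIV H)"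

definition C2_boundary :: "(real ^ 'n) set \<Rightarrow> bool" where
  "C2_boundary \<Omega> \<longleftrightarrow> (\<forall>x0 \<in> frontier \<Omega>. \<exists>r > 0. \<exists>e \<gamma>.
     norm e = 1 \<and> C2_function \<gamma> \<and> (\<forall>x c. \<gamma> (x + c *\<^sub>R e) = \<gamma> x) \<and>
     \<Omega> \<inter> ball x0 r = {x \<in> ball x0 r. \<gamma> x < x \<bullet> e})"

definition C2_domain :: "(real ^ 'n) set \<Rightarrow> bool" where
  "C2_domain \<Omega> \<longleftrightarrow>
     open \<Omega> \<and> connected \<Omega> \<and> \<Omega> \<noteq> {} \<and> bounded \<Omega> \<and> C2_boundary \<Omega>"

definition bdist :: "(real ^ 'n) set \<Rightarrow> real ^ 'n \<Rightarrow> real" where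
  "bdist \<Omega> x = infdist x (frontier \<Omega>)"

definition inner_part :: "(real ^ 'n) set \<Rightarrow> real \<Rightarrow> (real ^ 'n) set" where
  "inner_part \<Omega> s = {x \<in> \<Omega>. bdist \<Omega> x > s}"

definition Lp_on :: "'a::euclidean_space set \<Rightarrow> real \<Rightarrow> ('a \<Rightarrow> 'b::euclidean_space) \<Rightarrow> bool" where
  "Lp_on S q f \<longleftrightarrow> f \<in> borel_measurable (lebesgue_on S) \<and>
     set_integrable lebesgue S (\<lambda>x. norm (f x) powr q)"

definition Lp_loc :: "'a::euclidean_space set \<Rightarrow> real \<Rightarrow> ('a \<Rightarrow> 'b::euclidean_space) \<Rightarrow> bool" where
  "Lp_loc S q f \<longleftrightarrow> (\<forall>K. compact K \<and> K \<subseteq> S \<longrightarrow> Lp_on K q f)"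

definition Lp_norm :: "'a::euclidean_space set \<Rightarrow> real \<Rightarrow> ('a \<Rightarrow> real) \<Rightarrow> real" where
  "Lp_norm S q f = (LINT x:S|lebesgue. \<bar>f x\<bar> powr q) powr (1 / q)"

text \<open>Test functions of class \<open>C\<^sup>1\<close> with compact support, paired with their gradient.\<close>

definition C1_compact :: "'a::euclidean_space set \<Rightarrow> ('a \<Rightarrow> real) \<Rightarrow> ('a \<Rightarrow> 'a) \<Rightarrow> bool" where
  "C1_compact S \<phi> D\<phi> \<longleftrightarrow>
     (\<forall>x. (\<phi> has_derivative (\<lambda>h. D\<phi> x \<bullet> h)) (at x)) \<and> continuous_on UNIV D\<phi> \<and>
     compact (closure {x. \<phi> x \<noteq> 0}) \<and> closure {x. \<phi> x \<noteq> 0} \<subseteq> S"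

definition weak_gradient ::
    "(real ^ 'n) set \<Rightarrow> (real ^ 'n \<Rightarrow> real) \<Rightarrow> (real ^ 'n \<Rightarrow> real ^ 'n) \<Rightarrow> bool" where
  "weak_gradient \<Omega> v G \<longleftrightarrow>
     (\<forall>K. compact K \<and> K \<subseteq> \<Omega> \<longrightarrow> set_integrable lebesgue K v \<and> set_integrable lebesgue K G) \<and>
     (\<forall>\<phi> D\<phi>. C1_compact \<Omega> \<phi> D\<phi> \<longrightarrow>
        (\<forall>i. (LINT x:\<Omega>|lebesgue. v x * D\<phi> x $ i) = - (LINT x:\<Omega>|lebesgue. G x $ i * \<phi> x)))"

definition W1 :: "(real ^ 'n) set \<Rightarrow> real \<Rightarrow> (real ^ 'n \<Rightarrow> real) \<Rightarrow> bool" where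
  "W1 \<Omega> q v \<longleftrightarrow> Lp_on \<Omega> q v \<and> (\<exists>G. weak_gradient \<Omega> v G \<and> Lp_on \<Omega> q G)"

text \<open>The weak gradient is unique up to null sets, so the norm does not depend on the choice.\<close>

definition W1_norm :: "(real ^ 'n) set \<Rightarrow> real \<Rightarrow> (real ^ 'n \<Rightarrow> real) \<Rightarrow> real" where
  "W1_norm \<Omega> q v =
     ((LINT x:\<Omega>|lebesgue. \<bar>v x\<bar> powr q) +
      (LINT x:\<Omega>|lebesgue. norm ((SOME G. weak_gradient \<Omega> v G) x) powr q)) powr (1 / q)"

definition vanishes_off ::
    "(real ^ 'n) set \<Rightarrow> (real ^ 'n) set \<Rightarrow> (real ^ 'n \<Rightarrow> real) \<Rightarrow> bool" where
  "vanishes_off \<Omega> K v \<longleftrightarrow> (AE x in lebesgue. x \<in> \<Omega> - K \<longrightarrow> v x = 0)"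

definition W1_supp :: "(real ^ 'n) set \<Rightarrow> real \<Rightarrow> (real ^ 'n) set \<Rightarrow> (real ^ 'n \<Rightarrow> real) set" where
  "W1_supp \<Omega> q K = {v. W1 \<Omega> q v \<and> vanishes_off \<Omega> K v}"

definition Lp_supp :: "(real ^ 'n) set \<Rightarrow> real \<Rightarrow> (real ^ 'n) set \<Rightarrow> (real ^ 'n \<Rightarrow> real) set" where
  "Lp_supp \<Omega> q K = {v. Lp_on \<Omega> q v \<and> vanishes_off \<Omega> K v}"

definition compactly_supp ::
    "(real ^ 'n) set \<Rightarrow> ((real ^ 'n) set \<Rightarrow> (real ^ 'n \<Rightarrow> real) set) \<Rightarrow> (real ^ 'n \<Rightarrow> real) set" where
  "compactly_supp \<Omega> V = (\<Union>K \<in> {K. compact K \<and> K \<subseteq> \<Omega>}. V K)"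

text \<open>The space \<open>L\<^sup>q\<close>, locally on \<open>(0,T)\<close>, with values in the dual of the compactly supported
  functions of a space. The latter carries the inductive limit topology over the
  subspaces \<open>V K\<close> of functions supported in a compact \<open>K \<subseteq> \<Omega>\<close>, so its dual consists of the linear
  functionals bounded (for the norm \<open>N\<close>) on each \<open>V K\<close>: no uniformity up to the boundary is imposed.\<close>

definition Lloc_dual ::
    "(real ^ 'n) set \<Rightarrow> real \<Rightarrow> real \<Rightarrow> ((real ^ 'n) set \<Rightarrow> (real ^ 'n \<Rightarrow> real) set) \<Rightarrow>
     ((real ^ 'n \<Rightarrow> real) \<Rightarrow> real) \<Rightarrow> (real \<Rightarrow> (real ^ 'n \<Rightarrow> real) \<Rightarrow> real) \<Rightarrow> bool" where
  "Lloc_dual \<Omega> T q V N D \<longleftrightarrow>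
     (\<forall>t \<in> {0<..<T}. \<forall>v \<in> compactly_supp \<Omega> V. \<forall>w \<in> compactly_supp \<Omega> V. \<forall>\<alpha> \<beta>.
        D t (\<lambda>x. \<alpha> * v x + \<beta> * w x) = \<alpha> * D t v + \<beta> * D t w) \<and>
     (\<forall>v \<in> compactly_supp \<Omega> V. (\<lambda>t. D t v) \<in> borel_measurable (lebesgue_on {0<..<T})) \<and>
     (\<forall>K. compact K \<and> K \<subseteq> \<Omega> \<longrightarrow>
        (\<exists>M :: real \<Rightarrow> real. Lp_loc {0<..<T} q M \<and>
             (\<forall>t \<in> {0<..<T}. \<forall>v \<in> V K. \<bar>D t v\<bar> \<le> M t * N v)))"

definition spow :: "real \<Rightarrow> real \<Rightarrow> real" where
  "spow q r = \<bar>r\<bar> powr (q - 1) * r"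

text \<open>\<open>D1 + D2\<close> is the derivative in \<open>t\<close> of \<open>spow p (u t)\<close> in the sense of distributions on
  \<open>(0,T)\<close> with values in the dual of \<open>W\<^sub>c \<inter> L\<^sub>c\<close>.\<close>

definition time_derivative ::
    "(real ^ 'n) set \<Rightarrow> real \<Rightarrow> real \<Rightarrow> real \<Rightarrow> (real \<Rightarrow> real ^ 'n \<Rightarrow> real) \<Rightarrow>
     (real \<Rightarrow> (real ^ 'n \<Rightarrow> real) \<Rightarrow> real) \<Rightarrow> (real \<Rightarrow> (real ^ 'n \<Rightarrow> real) \<Rightarrow> real) \<Rightarrow> bool" where
  "time_derivative \<Omega> T p lam u D1 D2 \<longleftrightarrow>
     (\<forall>v \<in> compactly_supp \<Omega> (W1_supp \<Omega> (p + 1)) \<inter> compactly_supp \<Omega> (Lp_supp \<Omega> (lam + 1)).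
      \<forall>\<phi> D\<phi>. C1_compact {0<..<T} \<phi> D\<phi> \<longrightarrow>
        (LINT t:{0<..<T}|lebesgue. (D1 t v + D2 t v) * \<phi> t) =
        - (LINT t:{0<..<T}|lebesgue. (LINT x:\<Omega>|lebesgue. spow p (u t x) * v x) * D\<phi> t))"

text \<open>Test functions \<open>\<eta>\<close> with spatial gradient \<open>D\<eta>\<close>. As usual for functions with
  values in an inductive limit, the supports of \<open>\<eta> t\<close> stay in one compact subset of \<open>\<Omega>\<close>
  while \<open>t\<close> stays in a compact subinterval of \<open>(0,T)\<close>.\<close>

definition test_function ::
    "(real ^ 'n) set \<Rightarrow> real \<Rightarrow> real \<Rightarrow> real \<Rightarrow>
     (real \<Rightarrow> real ^ 'n \<Rightarrow> real) \<Rightarrow> (real \<Rightarrow> real ^ 'n \<Rightarrow> real ^ 'n) \<Rightarrow> bool" where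
  "test_function \<Omega> T p lam \<eta> D\<eta> \<longleftrightarrow>
     (\<forall>t1 t2. 0 < t1 \<and> t1 < t2 \<and> t2 < T \<longrightarrow>
        Lp_on ({t1..t2} \<times> \<Omega>) (p + 1) (\<lambda>(t, x). \<eta> t x) \<and>
        Lp_on ({t1..t2} \<times> \<Omega>) (p + 1) (\<lambda>(t, x). D\<eta> t x) \<and>
        Lp_on ({t1..t2} \<times> \<Omega>) (lam + 1) (\<lambda>(t, x). \<eta> t x) \<and>
        (\<exists>K. compact K \<and> K \<subseteq> \<Omega> \<and>
          (AE t in lebesgue. t \<in> {t1..t2} \<longrightarrow>
             \<eta> t \<in> W1_supp \<Omega> (p + 1) K \<inter> Lp_supp \<Omega> (lam + 1) K \<and>
             weak_gradient \<Omega> (\<eta> t) (D\<eta> t))))"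

text \<open>Weak (energy) solutions \<open>u\<close>, with \<open>Du\<close> the (jointly measurable) weak spatial
  gradient of \<open>u\<close>.\<close>

definition energy_solution ::
    "(real ^ 'n) set \<Rightarrow> real \<Rightarrow> real \<Rightarrow> real \<Rightarrow>
     (real \<Rightarrow> real ^ 'n \<Rightarrow> real \<Rightarrow> real ^ 'n \<Rightarrow> real ^ 'n) \<Rightarrow> (real \<Rightarrow> real ^ 'n \<Rightarrow> real) \<Rightarrow>
     (real \<Rightarrow> real ^ 'n \<Rightarrow> real) \<Rightarrow> (real \<Rightarrow> real ^ 'n \<Rightarrow> real ^ 'n) \<Rightarrow> bool" where
  "energy_solution \<Omega> T p lam A b u Du \<longleftrightarrow>
     (\<forall>t \<in> {0<..<T}. Lp_on \<Omega> (p + 1) (u t) \<and>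
        ((\<lambda>r. Lp_norm \<Omega> (p + 1) (\<lambda>x. u r x - u t x)) \<longlongrightarrow> 0) (at t)) \<and>
     (AE t in lebesgue. t \<in> {0<..<T} \<longrightarrow> weak_gradient \<Omega> (u t) (Du t)) \<and>
     Lp_loc ({0<..<T} \<times> \<Omega>) (p + 1) (\<lambda>(t, x). u t x) \<and>
     Lp_loc ({0<..<T} \<times> \<Omega>) (p + 1) (\<lambda>(t, x). Du t x) \<and>
     Lp_loc ({0<..<T} \<times> \<Omega>) (lam + 1) (\<lambda>(t, x). u t x) \<and>
     (\<exists>D1 D2.
        Lloc_dual \<Omega> T ((p + 1) / p) (W1_supp \<Omega> (p + 1)) (W1_norm \<Omega> (p + 1)) D1 \<and>
        Lloc_dual \<Omega> T ((lam + 1) / lam) (Lp_supp \<Omega> (lam + 1)) (Lp_norm \<Omega> (lam + 1)) D2 \<and>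
        time_derivative \<Omega> T p lam u D1 D2 \<and>
        (\<forall>\<eta> D\<eta> t1 t2. test_function \<Omega> T p lam \<eta> D\<eta> \<and> 0 < t1 \<and> t1 < t2 \<and> t2 < T \<longrightarrow>
           (LINT t:{t1..t2}|lebesgue. D1 t (\<eta> t) + D2 t (\<eta> t)) +
           (LINT t:{t1..t2}|lebesgue. LINT x:\<Omega>|lebesgue.
              (\<Sum>i\<in>UNIV. A t x (u t x) (Du t x) $ i * D\<eta> t x $ i) + b t x * spow lam (u t x) * \<eta> t x)
           = 0))"

definition local_energy ::
    "(real ^ 'n) set \<Rightarrow> real \<Rightarrow> real \<Rightarrow>
     (real \<Rightarrow> real ^ 'n \<Rightarrow> real) \<Rightarrow> (real \<Rightarrow> real ^ 'n \<Rightarrow> real ^ 'n) \<Rightarrow> real \<Rightarrow> real \<Rightarrow> real" where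
  "local_energy \<Omega> T p u Du t s =
     (LINT x:inner_part \<Omega> s|lebesgue. \<bar>u t x\<bar> powr (p + 1)) +
     (LINT \<tau>:{T / 2..t}|lebesgue. LINT x:inner_part \<Omega> s|lebesgue. norm (Du \<tau> x) powr (p + 1))"

definition two_sided ::
    "(real ^ 'n) set \<Rightarrow> real \<Rightarrow> (real \<Rightarrow> real) \<Rightarrow> (real \<Rightarrow> real) \<Rightarrow>
     (real \<Rightarrow> real) \<Rightarrow> (real \<Rightarrow> real) \<Rightarrow> (real \<Rightarrow> real ^ 'n \<Rightarrow> real) \<Rightarrow> bool" where
  "two_sided \<Omega> T a1 a2 g1 g2 b \<longleftrightarrow> (\<forall>t \<in> {0..<T}. \<forall>x \<in> \<Omega>.
     a1 t * g1 (bdist \<Omega> x) \<le> b t x \<and> b t x \<le> a2 t * g2 (bdist \<Omega> x))"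

definition s0' :: "real \<Rightarrow> real \<Rightarrow> real \<Rightarrow> real \<Rightarrow> real" where
  "s0' c3 p \<mu> \<omega> = c3 * min 1 (\<omega> powr ((p + \<mu>) / (p + 1)))"

text \<open>\<open>K1\<close>, \<open>K2\<close>, \<open>c3\<close> are constants of the general interior estimate for the equation
  with coefficients \<open>A\<close>, \<open>b\<close>: they serve all admissible \<open>g1\<close>, \<open>g2\<close> and all \<open>u\<close>, \<open>t\<close>, \<open>s\<close>. Constants
  which moreover depend on fewer of the data are a special case. The infimum is
  a minimum, the expression being continuous in \<open>r\<close> and tending to infinity at \<open>0\<close> and \<open>s\<close>.\<close>

definition estimate_constants ::
    "(real ^ 'n) set \<Rightarrow> real \<Rightarrow> real \<Rightarrow> real \<Rightarrow> real \<Rightarrow> real \<Rightarrow> (real \<Rightarrow> real) \<Rightarrow> (real \<Rightarrow> real) \<Rightarrow>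
     (real \<Rightarrow> real ^ 'n \<Rightarrow> real \<Rightarrow> real ^ 'n \<Rightarrow> real ^ 'n) \<Rightarrow> (real \<Rightarrow> real ^ 'n \<Rightarrow> real) \<Rightarrow>
     real \<Rightarrow> real \<Rightarrow> real \<Rightarrow> bool" where
  "estimate_constants \<Omega> T p lam \<mu> \<omega> a1 a2 A b K1 K2 c3 \<longleftrightarrow>
     0 < K1 \<and> 0 < K2 \<and> 0 < c3 \<and>
     (\<forall>g1 g2 u Du.
        mono_on {0..} g1 \<and> mono_on {0..} g2 \<and> (\<forall>h > 0. 0 < g1 h) \<and> (\<forall>h \<ge> 0. g1 h \<le> g2 h) \<and>
        two_sided \<Omega> T a1 a2 g1 g2 b \<and> energy_solution \<Omega> T p lam A b u Du \<longrightarrow>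
        (\<forall>t \<in> {T / 2<..<T}. \<forall>s \<in> {0<..<s0' c3 p \<mu> \<omega>}.
           local_energy \<Omega> T p u Du t s \<le>
           K1 * (INF r \<in> {0<..<s}.
             exp (K2 * \<omega> powr ((p + \<mu>) / \<mu>) * (s - r) powr (- ((p + 1) / \<mu>))) *
             (LINT h:{0..r}|lebesgue. g1 h powr ((p + 1) / (1 + p * (lam + 2))))
               powr (- ((1 + p * (lam + 2)) / (lam - p))))))"

text \<open>The restriction \<open>r \<le> 1\<close> says that the real power has a nonnegative base.\<close>

definition rho_equation :: "real \<Rightarrow> real \<Rightarrow> real \<Rightarrow> real \<Rightarrow> bool" where
  "rho_equation p \<mu> \<tau> r \<longleftrightarrow> r \<le> 1 \<and> r - \<tau> * (1 - r) powr ((p + \<mu> + 1) / \<mu>) = 0"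

definition rho :: "real \<Rightarrow> real \<Rightarrow> real \<Rightarrow> real" where
  "rho p \<mu> \<tau> = (THE r. rho_equation p \<mu> \<tau> r)"

end

theory Submission
  imports Defs
begin

text \<open>The general estimate bounds the energy on the inner domain by a minimum over a free radius in
  \<open>(0,s)\<close>, so every choice of the radius gives a bound. For a power \<open>g\<^sub>1\<close> the integral in that
  estimate is explicit (\<open>power_weight_factor\<close>, where the exponents combine to \<open>\<kappa>\<close>), and the radius
  \<open>\<rho> s\<close> turns it into the asserted right-hand side for any \<open>\<rho> \<in> (0,1)\<close> (\<open>estimate_at_fraction\<close>).

  The particular \<open>\<rho>\<close> is the best such fraction: with \<open>B = K\<^sub>2 \<omega>\<^bsup>(p+\<mu>)/\<mu>\<^esup> s\<^bsup>-(p+1)/\<mu>\<^esup>\<close>, the logarithm of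
  the right-hand side is, up to a constant, the convex function \<open>B (1 - \<rho>)\<^bsup>-(p+1)/\<mu>\<^esup> - \<kappa> ln \<rho>\<close>, and
  its derivative vanishes where \<open>\<rho> = \<tau> (1 - \<rho>)\<^bsup>q\<^esup>\<close> with \<open>q = (p + \<mu> + 1) / \<mu>\<close> and
  \<open>\<tau> = \<mu> \<kappa> / ((p + 1) B)\<close>. Existence, uniqueness and monotonicity of the solution come from
  the monotonicity of \<open>r - \<tau> (1 - r)\<^bsup>q\<^esup>\<close> in \<open>r\<close> and \<open>\<tau>\<close>, and the asymptotics at \<open>0\<close> from
  \<open>0 < \<rho> \<le> \<tau>\<close> together with \<open>\<rho> / \<tau> = (1 - \<rho>)\<^bsup>q\<^esup>\<close>.\<close>

section \<open>The optimal fraction\<close>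

lemma rho_equation_fixpoint:
  assumes "rho_equation p \<mu> \<tau> r"
  shows "r = \<tau> * (1 - r) powr ((p + \<mu> + 1) / \<mu>)"
  using assms unfolding rho_equation_def by linarith

lemma rho_equation_pos_less_1:
  assumes "0 < \<tau>" "rho_equation p \<mu> \<tau> r"
  shows "0 < r" "r < 1"
proof -
  note eq = rho_equation_fixpoint[OF assms(2)]
  have "r \<le> 1"
    using assms(2) by (simp add: rho_equation_def)
  have "r \<noteq> 1"
    using eq by auto
  with \<open>r \<le> 1\<close> show "r < 1"
    by simp
  then have "0 < \<tau> * (1 - r) powr ((p + \<mu> + 1) / \<mu>)"
    using \<open>0 < \<tau>\<close> by simp
  with eq show "0 < r"
    by linarith
qed

text \<open>The right-hand side of \<open>r = \<tau> (1 - r)\<^bsup>q\<^esup>\<close> decreases in \<open>r\<close> and increases in \<open>\<tau>\<close>. The weak form,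
  applied in both directions to equal parameters, gives uniqueness.\<close>

lemma rho_equation_mono:
  assumes "0 < p" "0 < \<mu>" "0 < \<tau>" "\<tau> \<le> \<tau>'"
    and "rho_equation p \<mu> \<tau> r" "rho_equation p \<mu> \<tau>' r'"
  shows "r \<le> r'" "\<tau> < \<tau>' \<Longrightarrow> r < r'"
proof -
  let ?q = "(p + \<mu> + 1) / \<mu>"
  have q: "0 < ?q"
    using assms by simp
  note eq = rho_equation_fixpoint[OF assms(5)] rho_equation_fixpoint[OF assms(6)]
  have lt1: "r < 1" "r' < 1"
    using rho_equation_pos_less_1(2)[OF _ assms(5)] rho_equation_pos_less_1(2)[OF _ assms(6)]
      \<open>0 < \<tau>\<close> \<open>\<tau> \<le> \<tau>'\<close> by linarith+
  show le: "r \<le> r'"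
  proof (rule ccontr)
    assume "\<not> r \<le> r'"
    then have "(1 - r) powr ?q \<le> (1 - r') powr ?q"
      using q lt1 by (intro powr_mono2) auto
    then have "\<tau> * (1 - r) powr ?q \<le> \<tau>' * (1 - r') powr ?q"
      using \<open>0 < \<tau>\<close> \<open>\<tau> \<le> \<tau>'\<close> by (intro mult_mono) auto
    with eq \<open>\<not> r \<le> r'\<close> show False
      by linarith
  qed
  show "r < r'" if "\<tau> < \<tau>'"
  proof (rule ccontr)
    assume "\<not> r < r'"
    with le have "r' = r"
      by simp
    have "\<tau> * (1 - r) powr ?q < \<tau>' * (1 - r) powr ?q"
      using that lt1 by simp
    with eq show False
      unfolding \<open>r' = r\<close> by linarith
  qed
qed

lemma rho_equation_ex1:
  assumes "0 < p" "0 < \<mu>" "0 < \<tau>"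
  shows "\<exists>!r. rho_equation p \<mu> \<tau> r"
proof (rule ex_ex1I)
  let ?q = "(p + \<mu> + 1) / \<mu>"
  let ?f = "\<lambda>r. r - \<tau> * (1 - r) powr ?q"
  have "0 < ?q"
    using assms by simp
  then have "continuous_on {0..1} ?f"
    by (intro continuous_intros continuous_on_powr') auto
  moreover have "?f 0 \<le> 0" "0 \<le> ?f 1"
    using assms by auto
  ultimately obtain r where "0 \<le> r" "r \<le> 1" "?f r = 0"
    using IVT'[of ?f 0 0 1] by auto
  then show "\<exists>r. rho_equation p \<mu> \<tau> r"
    by (auto simp: rho_equation_def)
next
  fix r r'
  assume "rho_equation p \<mu> \<tau> r" "rho_equation p \<mu> \<tau> r'"
  then show "r = r'"
    using rho_equation_mono(1)[OF assms order_refl] by (meson order_antisym)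
qed

lemma rho_equation_rho:
  assumes "0 < p" "0 < \<mu>" "0 < \<tau>"
  shows "rho_equation p \<mu> \<tau> (rho p \<mu> \<tau>)"
  unfolding rho_def by (rule theI'[OF rho_equation_ex1[OF assms]])

lemma rho_between_0_1:
  assumes "0 < p" "0 < \<mu>" "0 < \<tau>"
  shows "0 < rho p \<mu> \<tau>" "rho p \<mu> \<tau> < 1"
  using rho_equation_pos_less_1[OF assms(3) rho_equation_rho[OF assms]] by auto

lemma rho_strict_mono:
  assumes "0 < p" "0 < \<mu>"
  shows "strict_mono_on {0<..} (rho p \<mu>)"
proof (rule strict_mono_onI)
  fix \<tau> \<tau>' :: real
  assume "\<tau> \<in> {0<..}" "\<tau>' \<in> {0<..}" "\<tau> < \<tau>'"
  then have \<tau>: "0 < \<tau>" "0 < \<tau>'" "\<tau> \<le> \<tau>'" "\<tau> < \<tau>'"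
    by auto
  show "rho p \<mu> \<tau> < rho p \<mu> \<tau>'"
    by (rule rho_equation_mono(2)[OF assms \<tau>(1,3) rho_equation_rho[OF assms \<tau>(1)]
          rho_equation_rho[OF assms \<tau>(2)] \<tau>(4)])
qed

lemma rho_asymp_at_0:
  assumes "0 < p" "0 < \<mu>"
  shows "((\<lambda>\<tau>. rho p \<mu> \<tau> / \<tau>) \<longlongrightarrow> 1) (at_right 0)"
proof -
  let ?q = "(p + \<mu> + 1) / \<mu>"
  have eq: "rho p \<mu> \<tau> = \<tau> * (1 - rho p \<mu> \<tau>) powr ?q" if "0 < \<tau>" for \<tau>
    using rho_equation_fixpoint[OF rho_equation_rho[OF assms that]] .
  have le: "rho p \<mu> \<tau> \<le> \<tau>" if "0 < \<tau>" for \<tau>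
  proof -
    have "(1 - rho p \<mu> \<tau>) powr ?q \<le> 1"
      using assms rho_between_0_1[OF assms that] by (intro powr_le1) auto
    then have "\<tau> * (1 - rho p \<mu> \<tau>) powr ?q \<le> \<tau>"
      using that by simp
    with eq[OF that] show ?thesis
      by linarith
  qed
  have pos: "\<forall>\<^sub>F \<tau> in at_right 0. (0::real) < \<tau>"
    by (rule eventually_at_right_less)
  have "(rho p \<mu> \<longlongrightarrow> 0) (at_right 0)"
  proof (rule tendsto_sandwich[where f = "\<lambda>_. 0" and h = "\<lambda>\<tau>. \<tau>"])
    show "\<forall>\<^sub>F \<tau> in at_right 0. 0 \<le> rho p \<mu> \<tau>"
      by (rule eventually_mono[OF pos]) (rule less_imp_le[OF rho_between_0_1(1)[OF assms]])
    show "\<forall>\<^sub>F \<tau> in at_right 0. rho p \<mu> \<tau> \<le> \<tau>"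
      by (rule eventually_mono[OF pos le])
  qed (rule tendsto_const tendsto_ident_at)+
  then have "((\<lambda>\<tau>. (1 - rho p \<mu> \<tau>) powr ?q) \<longlongrightarrow> (1 - 0) powr ?q) (at_right 0)"
    by (intro tendsto_powr tendsto_diff tendsto_const) simp_all
  moreover have "\<forall>\<^sub>F \<tau> in at_right 0. (1 - rho p \<mu> \<tau>) powr ?q = rho p \<mu> \<tau> / \<tau>"
    using pos
  proof eventually_elim
    fix \<tau> :: real
    assume "0 < \<tau>"
    then show "(1 - rho p \<mu> \<tau>) powr ?q = rho p \<mu> \<tau> / \<tau>"
      using eq[of \<tau>, symmetric] by (simp add: nonzero_eq_divide_eq mult.commute)
  qed
  ultimately show ?thesis
    using Lim_transform_eventually[of _ "(1 - 0) powr ?q"] by simp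
qed

section \<open>The estimate for power weights\<close>

lemma set_lebesgue_integral_powr_from_0:
  fixes \<alpha> r :: real
  assumes "-1 < \<alpha>" "0 \<le> r"
  shows "(LINT h:{0..r}|lebesgue. h powr \<alpha>) = r powr (\<alpha> + 1) / (\<alpha> + 1)"
proof -
  have hi: "((\<lambda>h. h powr \<alpha>) has_integral (r powr (\<alpha> + 1) / (\<alpha> + 1))) {0..r}"
    using has_integral_powr_from_0[OF assms] .
  then have "(\<lambda>h. h powr \<alpha>) absolutely_integrable_on {0..r}"
    by (intro nonnegative_absolutely_integrable_1) (auto simp: integrable_on_def)
  then show ?thesis
    using hi by (simp add: set_lebesgue_integral_eq_integral(2) integral_unique)
qed

lemma integral_power_weight:
  fixes a \<nu> \<theta> r :: real
  assumes "0 < a" "0 < \<nu>" "0 < \<theta>" "0 \<le> r" and g: "\<forall>s\<ge>0. g s = a * s powr \<nu>"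
  shows "(LINT h:{0..r}|lebesgue. g h powr \<theta>) = a powr \<theta> * r powr (1 + \<nu> * \<theta>) / (1 + \<nu> * \<theta>)"
proof -
  have "(LINT h:{0..r}|lebesgue. g h powr \<theta>) = (LINT h:{0..r}|lebesgue. a powr \<theta> * h powr (\<nu> * \<theta>))"
    using assms by (intro set_lebesgue_integral_cong) (auto simp: powr_mult powr_powr)
  also have "\<dots> = a powr \<theta> * (r powr (\<nu> * \<theta> + 1) / (\<nu> * \<theta> + 1))"
    using assms set_lebesgue_integral_powr_from_0[of "\<nu> * \<theta>" r]
      mult_pos_pos[OF \<open>0 < \<nu>\<close> \<open>0 < \<theta>\<close>] by simp
  finally show ?thesis
    by (simp add: add.commute)
qed

text \<open>Write \<open>\<lambda>\<close> for \<open>lam\<close>. With \<open>\<theta> = (p + 1) / (1 + p (\<lambda> + 2))\<close> and \<open>m = (1 + p (\<lambda> + 2)) / (\<lambda> - p)\<close>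
  the left-hand side is \<open>(a\<^bsup>\<theta>\<^esup> r\<^bsup>1 + \<nu> \<theta>\<^esup> / (1 + \<nu> \<theta>))\<^bsup>-m\<^esup>\<close>. Here \<open>\<theta> m = (p + 1) / (\<lambda> - p)\<close>, and
  \<open>(1 + \<nu> \<theta>) m\<close> is the exponent \<open>\<kappa>\<close> of the final bound.\<close>

lemma power_weight_factor:
  fixes p lam a \<nu> r :: real
  assumes "0 < p" "p < lam" "0 < a" "0 < \<nu>" "0 < r" and g: "\<forall>s\<ge>0. g s = a * s powr \<nu>"
  shows "(LINT h:{0..r}|lebesgue. g h powr ((p + 1) / (1 + p * (lam + 2))))
           powr (- ((1 + p * (lam + 2)) / (lam - p)))
         = a powr (- ((p + 1) / (lam - p)))
           * (1 + \<nu> * (p + 1) / (1 + p * (lam + 2))) powr ((1 + p * (lam + 2)) / (lam - p))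
           * r powr (- (((\<nu> + 1) * (p + 1) + p * (lam + 1)) / (lam - p)))"
proof -
  define D where "D = 1 + p * (lam + 2)"
  define \<theta> where "\<theta> = (p + 1) / D"
  define m where "m = D / (lam - p)"
  have "0 < D"
    using assms by (auto simp: D_def intro!: add_pos_pos)
  then have "0 < \<theta>"
    using assms by (simp add: \<theta>_def)
  have pos: "0 < 1 + \<nu> * \<theta>"
    using assms \<open>0 < \<theta>\<close> by (simp add: add_pos_pos)
  have \<theta>m: "\<theta> * m = (p + 1) / (lam - p)"
    using \<open>0 < D\<close> by (simp add: \<theta>_def m_def)
  have "(1 + \<nu> * \<theta>) * m = m + \<nu> * (\<theta> * m)"
    by (simp add: algebra_simps)
  also have "\<dots> = (D + \<nu> * (p + 1)) / (lam - p)"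
    by (subst \<theta>m) (simp only: m_def add_divide_distrib[of D] times_divide_eq_right)
  also have "D + \<nu> * (p + 1) = (\<nu> + 1) * (p + 1) + p * (lam + 1)"
    by (simp add: D_def algebra_simps)
  finally have \<kappa>: "(1 + \<nu> * \<theta>) * m = ((\<nu> + 1) * (p + 1) + p * (lam + 1)) / (lam - p)" .
  have "(LINT h:{0..r}|lebesgue. g h powr \<theta>) powr (- m)
        = (a powr \<theta> * r powr (1 + \<nu> * \<theta>) / (1 + \<nu> * \<theta>)) powr (- m)"
    using integral_power_weight[OF \<open>0 < a\<close> \<open>0 < \<nu>\<close> \<open>0 < \<theta>\<close> _ g, of r] \<open>0 < r\<close> by simp
  also have "\<dots> = a powr (\<theta> * - m) * r powr ((1 + \<nu> * \<theta>) * - m) / (1 + \<nu> * \<theta>) powr (- m)"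
    using \<open>0 < a\<close> \<open>0 < r\<close> pos by (simp only: powr_divide powr_mult powr_powr)
  also have "\<dots> = a powr (- (\<theta> * m)) * (1 + \<nu> * \<theta>) powr m * r powr (- ((1 + \<nu> * \<theta>) * m))"
    by (simp only: powr_minus divide_inverse inverse_inverse_eq mult_minus_right mult_minus_left mult_ac)
  finally show ?thesis
    unfolding \<theta>m \<kappa> by (simp add: \<theta>_def m_def D_def)
qed

lemma power_weight_mono_pos:
  fixes a \<nu> :: real
  assumes "0 < a" "0 < \<nu>" "\<forall>s\<ge>0. g s = a * s powr \<nu>"
  shows "mono_on {0..} g" "\<forall>h>0. 0 < g h"
  using assms by (simp_all add: mono_on_def powr_mono2)

text \<open>The expression under the infimum is nonnegative, so the infimum is at most its value at the
  radius \<open>\<rho> s\<close>.\<close>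

lemma estimate_at_fraction:
  fixes \<Omega> :: "(real ^ 'n) set" and \<rho> :: real
  assumes "0 < p" "p < lam" "0 < a" "0 < \<nu>" "\<forall>s\<ge>0. g1 s = a * s powr \<nu>"
    and "mono_on {0..} g2" "\<forall>s\<ge>0. g1 s \<le> g2 s" "two_sided \<Omega> T a1 a2 g1 g2 b"
    and "energy_solution \<Omega> T p lam A b u Du"
    and "estimate_constants \<Omega> T p lam \<mu> \<omega> a1 a2 A b K1 K2 c3"
    and "t \<in> {T / 2<..<T}" "s \<in> {0<..<s0' c3 p \<mu> \<omega>}" "0 < \<rho>" "\<rho> < 1"
  defines "\<kappa> \<equiv> ((\<nu> + 1) * (p + 1) + p * (lam + 1)) / (lam - p)"
  shows "local_energy \<Omega> T p u Du t s \<le>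
         K1 * a powr (- ((p + 1) / (lam - p)))
         * (1 + \<nu> * (p + 1) / (1 + p * (lam + 2))) powr ((1 + p * (lam + 2)) / (lam - p))
         * exp (K2 * (1 - \<rho>) powr (- ((p + 1) / \<mu>)) * \<omega> powr ((p + \<mu>) / \<mu>)
                * s powr (- ((p + 1) / \<mu>)))
         * \<rho> powr (- \<kappa>) * s powr (- \<kappa>)"
proof -
  define F where "F = (\<lambda>r. exp (K2 * \<omega> powr ((p + \<mu>) / \<mu>) * (s - r) powr (- ((p + 1) / \<mu>))) *
    (LINT h:{0..r}|lebesgue. g1 h powr ((p + 1) / (1 + p * (lam + 2))))
      powr (- ((1 + p * (lam + 2)) / (lam - p))))"
  have "0 < s"
    using assms(12) by simp
  have K1: "0 < K1"
    using \<open>estimate_constants \<Omega> T p lam \<mu> \<omega> a1 a2 A b K1 K2 c3\<close>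
    by (simp add: estimate_constants_def)
  have admissible: "mono_on {0..} g1 \<and> mono_on {0..} g2 \<and> (\<forall>h>0. 0 < g1 h) \<and> (\<forall>h\<ge>0. g1 h \<le> g2 h) \<and>
      two_sided \<Omega> T a1 a2 g1 g2 b \<and> energy_solution \<Omega> T p lam A b u Du"
    using assms(5-9) power_weight_mono_pos[OF \<open>0 < a\<close> \<open>0 < \<nu>\<close> assms(5)] by blast
  have est: "local_energy \<Omega> T p u Du t s \<le> K1 * (INF r\<in>{0<..<s}. F r)"
    using \<open>estimate_constants \<Omega> T p lam \<mu> \<omega> a1 a2 A b K1 K2 c3\<close>[unfolded estimate_constants_def,
        THEN conjunct2, THEN conjunct2, THEN conjunct2, rule_format, OF admissible assms(11,12)]
    unfolding F_def .
  have "(INF r\<in>{0<..<s}. F r) \<le> F (\<rho> * s)"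
  proof (rule cINF_lower)
    show "bdd_below (F ` {0<..<s})"
      by (auto intro!: bdd_belowI2[where m = 0] simp: F_def)
    show "\<rho> * s \<in> {0<..<s}"
      using \<open>0 < \<rho>\<close> \<open>\<rho> < 1\<close> \<open>0 < s\<close> by simp
  qed
  with est K1 have "local_energy \<Omega> T p u Du t s \<le> K1 * F (\<rho> * s)"
    by (meson mult_left_mono less_imp_le order_trans)
  also have "K1 * F (\<rho> * s) =
         K1 * a powr (- ((p + 1) / (lam - p)))
         * (1 + \<nu> * (p + 1) / (1 + p * (lam + 2))) powr ((1 + p * (lam + 2)) / (lam - p))
         * exp (K2 * (1 - \<rho>) powr (- ((p + 1) / \<mu>)) * \<omega> powr ((p + \<mu>) / \<mu>)
                * s powr (- ((p + 1) / \<mu>)))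
         * \<rho> powr (- \<kappa>) * s powr (- \<kappa>)"
  proof -
    have "s - \<rho> * s = (1 - \<rho>) * s"
      by (simp add: algebra_simps)
    with \<open>\<rho> < 1\<close> \<open>0 < s\<close> have dist:
        "(s - \<rho> * s) powr (- ((p + 1) / \<mu>))
         = (1 - \<rho>) powr (- ((p + 1) / \<mu>)) * s powr (- ((p + 1) / \<mu>))"
      by (simp only: powr_mult)
    have radius: "(\<rho> * s) powr (- \<kappa>) = \<rho> powr (- \<kappa>) * s powr (- \<kappa>)"
      by (simp only: powr_mult)
    have "0 < \<rho> * s"
      using \<open>0 < \<rho>\<close> \<open>0 < s\<close> by simp
    note weight = power_weight_factor[OF assms(1-4) this assms(5), folded \<kappa>_def]
    show ?thesis
      unfolding F_def weight dist radius by (simp only: mult_ac)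
  qed
  finally show ?thesis .
qed

theorem corollary1p1:
  fixes \<Omega> :: "(real ^ 'n) set"
    and T p lam \<mu> \<omega> c0 d0 d1 a \<nu> K1 K2 c3 :: real
    and A :: "real \<Rightarrow> real ^ 'n \<Rightarrow> real \<Rightarrow> real ^ 'n \<Rightarrow> real ^ 'n"
    and b :: "real \<Rightarrow> real ^ 'n \<Rightarrow> real"
    and a1 a2 g1 g2 :: "real \<Rightarrow> real"
    and u :: "real \<Rightarrow> real ^ 'n \<Rightarrow> real"
    and Du :: "real \<Rightarrow> real ^ 'n \<Rightarrow> real ^ 'n"
  assumes "0 < p" and "p < lam" and "0 < T" and "C2_domain \<Omega>"
    and "0 < d0"
    and "continuous_on ({0..T} \<times> closure \<Omega> \<times> UNIV \<times> UNIV) (\<lambda>(t, x, s, \<xi>). A t x s \<xi>)"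
    and "\<forall>t \<in> {0..T}. \<forall>x \<in> closure \<Omega>. \<forall>s \<xi>.
           d0 * norm \<xi> powr (p + 1) \<le> (\<Sum>i\<in>UNIV. A t x s \<xi> $ i * \<xi> $ i) \<and>
           (\<forall>i. \<bar>A t x s \<xi> $ i\<bar> \<le> d1 * norm \<xi> powr p)"
    and "continuous_on ({0..T} \<times> closure \<Omega>) (\<lambda>(t, x). b t x)"
    and "\<forall>t \<in> {0..<T}. \<forall>x \<in> closure \<Omega>. 0 < b t x"
    and "\<forall>x \<in> \<Omega>. b T x = 0"
    and "0 < a" and "0 < \<nu>" and "\<forall>s \<ge> 0. g1 s = a * s powr \<nu>"
    and "mono_on {0..} g2" and "\<forall>s \<ge> 0. g1 s \<le> g2 s"
    and "two_sided \<Omega> T a1 a2 g1 g2 b"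
    and "0 < c0" and "0 < \<omega>" and "0 < \<mu>"
    and "continuous_on {0..<T} a1" and "continuous_on {0..<T} a2"
    and "\<forall>t \<in> {0..<T}. 0 < a1 t \<and> 0 < a2 t"
    and "\<forall>t \<in> {0..<T}. c0 * exp (- \<omega> * (T - t) powr (- (1 / (p + \<mu>)))) \<le> a1 t"
    and "energy_solution \<Omega> T p lam A b u Du"
    and "estimate_constants \<Omega> T p lam \<mu> \<omega> a1 a2 A b K1 K2 c3"
  shows "(let \<kappa> = ((\<nu> + 1) * (p + 1) + p * (lam + 1)) / (lam - p);
             K3 = K1 * a powr (- ((p + 1) / (lam - p))) *
                  (1 + \<nu> * (p + 1) / (1 + p * (lam + 2))) powr ((1 + p * (lam + 2)) / (lam - p))
         in \<forall>t \<in> {T / 2<..<T}. \<forall>s \<in> {0<..<s0' c3 p \<mu> \<omega>}.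
              let \<rho> = rho p \<mu> (\<mu> * \<kappa> * s powr ((p + 1) / \<mu>) /
                               (K2 * \<omega> powr ((p + \<mu>) / \<mu>) * (p + 1)))
              in local_energy \<Omega> T p u Du t s \<le>
                 K3 * exp (K2 * (1 - \<rho>) powr (- ((p + 1) / \<mu>)) * \<omega> powr ((p + \<mu>) / \<mu>)
                             * s powr (- ((p + 1) / \<mu>)))
                    * \<rho> powr (- \<kappa>) * s powr (- \<kappa>)) \<and>
         (\<forall>\<tau> > 0. (\<exists>!r. rho_equation p \<mu> \<tau> r) \<and> rho_equation p \<mu> \<tau> (rho p \<mu> \<tau>)) \<and>
         rho p \<mu> ` {0<..} \<subseteq> {0<..<1} \<and>
         strict_mono_on {0<..} (rho p \<mu>) \<and>
         ((\<lambda>\<tau>. rho p \<mu> \<tau> / \<tau>) \<longlongrightarrow> 1) (at_right 0)"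
proof -
  have "0 < \<nu> * (p + 1) + (p + 1) + p * (lam + 1)"
    using \<open>0 < p\<close> \<open>p < lam\<close> \<open>0 < \<nu>\<close> by (intro add_pos_pos mult_pos_pos) auto
  then have \<kappa>: "0 < ((\<nu> + 1) * (p + 1) + p * (lam + 1)) / (lam - p)"
    using \<open>p < lam\<close> by (simp add: algebra_simps)
  have K2: "0 < K2"
    using assms(25) by (simp only: estimate_constants_def)
  have "0 < \<mu> * k * s powr ((p + 1) / \<mu>) / (K2 * \<omega> powr ((p + \<mu>) / \<mu>) * (p + 1))"
    if "0 < k" "0 < s" for k s
    using \<open>0 < \<mu>\<close> K2 \<open>0 < \<omega>\<close> \<open>0 < p\<close> that by (intro divide_pos_pos mult_pos_pos) auto
  note frac = rho_between_0_1[OF \<open>0 < p\<close> \<open>0 < \<mu>\<close> this[OF \<kappa>]]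
  show ?thesis
    unfolding Let_def
    apply (intro conjI ballI allI impI)
    subgoal for t s
      by (rule estimate_at_fraction[OF assms(1,2,11-16,24,25)]) (simp_all only: frac greaterThanLessThan_iff)
    subgoal for \<tau>
      by (rule rho_equation_ex1[OF \<open>0 < p\<close> \<open>0 < \<mu>\<close>])
    subgoal for \<tau>
      by (rule rho_equation_rho[OF \<open>0 < p\<close> \<open>0 < \<mu>\<close>])
    subgoal
      using rho_between_0_1[OF \<open>0 < p\<close> \<open>0 < \<mu>\<close>] by auto
    subgoal
      by (rule rho_strict_mono[OF \<open>0 < p\<close> \<open>0 < \<mu>\<close>])
    subgoal
      by (rule rho_asymp_at_0[OF \<open>0 < p\<close> \<open>0 < \<mu>\<close>])
    done
qed

end
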